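(* Let $v,r,b,k$ be positive integers. If there exists a configuration $(v_r,b_k)$, then for each of the following three sets of parameters, every $(K,M,N)$ caching system with the given $K$ and the given ratio $\frac{M}{N}$ admits an $F$-division caching scheme with rate $R$: 1) $K=F=v$, $\ \frac{M}{N}=1-\frac{r}{v}$, $\ R=\frac{r}{k}$; 2) $K=v$, $\ \frac{M}{N}=1-\frac{k}{v}$, $\ R=\frac{k}{r}$, $\ F=\frac{vr}{k}$; 3) $K=\frac{vr}{k}$, $\ \frac{M}{N}=1-\frac{k}{v}$, $\ R=1$, $\ F=v$.
   Context: Configuration: a configuration $(v_r,b_k)$ is a pair $(V,\mathcal{B})$, where $V$ is a set of $v$ points and $\mathcal{B}$ is a set of $b$ distinct subsets of $V$ (blocks), such that (i) each block is a $k$-subset of $V$; (ii) each point is contained in exactly $r$ blocks; (iii) every $2$-subset of $V$ is contained in at most one block. (Then $bk=vr$, so $\frac{vr}{k}=b$ is an integer.) Caching system and caching scheme: fix a finite field $\mathbb{F}$ (e.g. $\mathbb{F}=\mathbb{F}_2$), and write $[n]=\{1,\dots,n\}$. A $(K,M,N)$ caching system consists of one server with $N$ files $\mathbf{W}_1,\dots,\mathbf{W}_N$ and $K$ users, each with a cache of size $M$, $0\le M\le N$. For a positive integer $F$ (the subpacketization; with $MF$ an integer), each file is a vector $\mathbf{W}_i\in\mathbb{F}^F$. An $F$-division caching scheme with rate $R$ for the $(K,M,N)$ caching system consists of: caching functions $\phi_k:\mathbb{F}^{NF}\to\mathbb{F}^{MF}$ for $k\in[K]$; encoding functions $\varphi_{\mathbf{d}}:\mathbb{F}^{NF}\to\mathbb{F}^{\lfloor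 RF\rfloor}$ for $\mathbf{d}\in[N]^K$; and decoding functions $\mu_{k,\mathbf{d}}:\mathbb{F}^{MF}\times\mathbb{F}^{\lfloor RF\rfloor}\to\mathbb{F}^{F}$ for $k\in[K]$, $\mathbf{d}\in[N]^K$; such that for all $k\in[K]$, all $\mathbf{d}=(d_1,\dots,d_K)\in[N]^K$, and all files $\mathbf{W}_1,\dots,\mathbf{W}_N\in\mathbb{F}^F$, $$\mathbf{W}_{d_k}=\mu_{k,\mathbf{d}}\bigl(\phi_k(\mathbf{W}_1,\dots,\mathbf{W}_N),\ \varphi_{\mathbf{d}}(\mathbf{W}_1,\dots,\mathbf{W}_N)\bigr).$$ (Here the user index $k\in[K]$ is unrelated to the block size $k$.) *)

theory Defs
  imports Complex_Main "HOL-Library.FuncSet" "Jordan_Normal_Form.Matrix"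
begin

text \<open>Distinctness of the blocks is built in, since \<open>\<B>\<close> is a set of sets.\<close>

definition configuration :: "'p set \<Rightarrow> 'p set set \<Rightarrow> nat \<Rightarrow> nat \<Rightarrow> nat \<Rightarrow> nat \<Rightarrow> bool" where
  "configuration V \<B> v r b k \<longleftrightarrow>
     finite V \<and> card V = v \<and>
     \<B> \<subseteq> Pow V \<and> card \<B> = b \<and>
     (\<forall>X\<in>\<B>. card X = k) \<and>
     (\<forall>x\<in>V. card {X \<in> \<B>. x \<in> X} = r) \<and>
     (\<forall>e. e \<subseteq> V \<and> card e = 2 \<longrightarrow> card {X \<in> \<B>. e \<subseteq> X} \<le> 1)"

text \<open>Consequently \<open>v * r div k\<close> is an exact division whenever a configuration exists.\<close>

lemma configuration_double_count:
  assumes "configuration V \<B> v r b k"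
  shows "b * k = v * r"
proof -
  have fV: "finite V" and fB: "finite \<B>"
    using assms finite_subset[of \<B> "Pow V"] by (auto simp: configuration_def)
  have "(\<Sum>X\<in>\<B>. card {x \<in> V. x \<in> X}) = (\<Sum>x\<in>V. card {X \<in> \<B>. x \<in> X})"
    using fV fB by (intro sum_multicount_gen) auto
  moreover have "card {x \<in> V. x \<in> X} = k" if "X \<in> \<B>" for X
  proof -
    have "{x \<in> V. x \<in> X} = X" using that assms by (auto simp: configuration_def)
    then show ?thesis using that assms by (simp add: configuration_def)
  qed
  ultimately show ?thesis using assms by (simp add: configuration_def)
qed

lemma configuration_div_exact:
  assumes "configuration V \<B> v r b k" and "0 < k"
  shows "v * r div k = b" and "real (v * r div k) = real v * real r / real k"
proof -
  have *: "v * r = b * k" using configuration_double_count[OF assms(1)] by simp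
  then show "v * r div k = b" using assms(2) by simp
  have "real v * real r = real b * real k" using * by (metis of_nat_mult)
  then show "real (v * r div k) = real v * real r / real k"
    using * assms(2) by simp
qed

definition caching_system :: "nat \<Rightarrow> real \<Rightarrow> nat \<Rightarrow> bool" where
  "caching_system K M N \<longleftrightarrow> 0 < K \<and> 0 < N \<and> 0 \<le> M \<and> M \<le> real N"

text \<open>The identification of \<open>N\<close> vectors \<open>W 1, \<dots>, W N\<close> of dimension \<open>F\<close> with
  one vector of dimension \<open>N * F\<close>, by concatenation (vector coordinates start at \<open>0\<close>).\<close>

definition concat_files :: "nat \<Rightarrow> nat \<Rightarrow> (nat \<Rightarrow> 'f vec) \<Rightarrow> 'f vec" where
  "concat_files N F W = vec (N * F) (\<lambda>i. W (i div F + 1) $ (i mod F))"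

definition caching_scheme ::
  "nat \<Rightarrow> real \<Rightarrow> nat \<Rightarrow> nat \<Rightarrow> real \<Rightarrow>
   (nat \<Rightarrow> 'f vec \<Rightarrow> 'f vec) \<Rightarrow>
   ((nat \<Rightarrow> nat) \<Rightarrow> 'f vec \<Rightarrow> 'f vec) \<Rightarrow>
   (nat \<Rightarrow> (nat \<Rightarrow> nat) \<Rightarrow> 'f vec \<times> 'f vec \<Rightarrow> 'f :: {field, finite} vec) \<Rightarrow> bool" where
  "caching_scheme K M N F R \<phi> \<psi> \<mu> \<longleftrightarrow>
     0 < F \<and> M * real F \<in> \<int> \<and>
     (\<forall>k\<in>{1..K}. \<phi> k \<in> carrier_vec (N * F) \<rightarrow> carrier_vec (nat \<lfloor>M * real F\<rfloor>)) \<and>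
     (\<forall>d \<in> {1..K} \<rightarrow>\<^sub>E {1..N}.
        \<psi> d \<in> carrier_vec (N * F) \<rightarrow> carrier_vec (nat \<lfloor>R * real F\<rfloor>)) \<and>
     (\<forall>k\<in>{1..K}. \<forall>d \<in> {1..K} \<rightarrow>\<^sub>E {1..N}.
        \<mu> k d \<in> carrier_vec (nat \<lfloor>M * real F\<rfloor>) \<times> carrier_vec (nat \<lfloor>R * real F\<rfloor>)
                 \<rightarrow> carrier_vec F) \<and>
     (\<forall>k\<in>{1..K}. \<forall>d \<in> {1..K} \<rightarrow>\<^sub>E {1..N}. \<forall>W \<in> {1..N} \<rightarrow> carrier_vec F.
        W (d k) = \<mu> k d (\<phi> k (concat_files N F W), \<psi> d (concat_files N F W)))"

text \<open>The type argument names the finite field over which the files are vectors.\<close>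

definition admits_caching_scheme ::
  "'f :: {field, finite} itself \<Rightarrow> nat \<Rightarrow> real \<Rightarrow> nat \<Rightarrow> nat \<Rightarrow> real \<Rightarrow> bool" where
  "admits_caching_scheme (_ :: 'f itself) K M N F R \<longleftrightarrow>
     (\<exists>\<phi> \<psi> (\<mu> :: nat \<Rightarrow> (nat \<Rightarrow> nat) \<Rightarrow> 'f vec \<times> 'f vec \<Rightarrow> 'f vec).
        caching_scheme K M N F R \<phi> \<psi> \<mu>)"

end

theory Submission imports Defs begin

text \<open>Fix on every block \<open>X\<close> a cyclic permutation \<open>g X\<close>. Since two blocks share at most one
  point, \<open>y \<in> X \<inter> Y\<close> and \<open>g X y \<in> Y\<close> force \<open>X = Y\<close>. Read the triples
  \<open>(y, g X y, X)\<close>, in three different orders, as (user, packet, signal): the user does not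
  cache the packet, and the signal contains it as a summand of a linear combination with all
  coefficients \<open>1\<close>. The property of \<open>g\<close> says precisely that a user caches every other summand
  of a signal that carries one of its missing packets, so that it can cancel them.\<close>

section \<open>Vector encodings and decodability\<close>

lemma concat_files_index:
  assumes "n \<in> {1..N}" and "j < F"
  shows "concat_files N F W $ ((n - 1) * F + j) = W n $ j"
proof -
  have "(n - 1) * F + j < Suc (n - 1) * F" using assms(2) by simp
  also have "\<dots> \<le> N * F" using assms(1) by (intro mult_le_mono1) auto
  finally show ?thesis using assms by (simp add: concat_files_def)
qed

text \<open>Listing the values along an enumeration of \<open>I\<close> does this. Cache contents
  and signals can then be treated as families over arbitrary finite sets; only the length and the
  injectivity of the encoding matter later.\<close>

lemma ex_vec_encoding:
  assumes "finite I"
  shows "\<exists>enc :: ('i \<Rightarrow> 'f) \<Rightarrow> 'f vec.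
    (\<forall>x. enc x \<in> carrier_vec (card I)) \<and>
    (\<forall>x y. enc x = enc y \<longrightarrow> (\<forall>i\<in>I. x i = y i))"
proof -
  obtain e where e: "bij_betw e {0..<card I} I"
    using ex_bij_betw_nat_finite[OF assms] by blast
  have "x i = y i"
    if "vec (card I) (\<lambda>n. x (e n)) = vec (card I) (\<lambda>n. y (e n))" and "i \<in> I"
    for x y :: "'i \<Rightarrow> 'f" and i
  proof -
    obtain n where "n < card I" "e n = i"
      using e \<open>i \<in> I\<close> unfolding bij_betw_def by (metis atLeastLessThan_iff imageE)
    then show ?thesis using that(1) by (metis index_vec)
  qed
  then show ?thesis
    by (intro exI[of _ "\<lambda>x. vec (card I) (\<lambda>n. x (e n))"]) auto
qed

text \<open>No explicit decoder is needed: once cache content and signal determine the demanded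
  file, a decoder may choose any files consistent with what the user sees. Natural numbers
  \<open>Z\<close> and \<open>S\<close> make the floors in the vector lengths disappear.\<close>

lemma admits_caching_schemeI:
  fixes \<phi> :: "nat \<Rightarrow> 'f :: {field, finite} vec \<Rightarrow> 'f vec"
    and \<psi> :: "(nat \<Rightarrow> nat) \<Rightarrow> 'f vec \<Rightarrow> 'f vec"
  assumes "0 < F" and MF: "M * real F = real Z" and RF: "R * real F = real S"
    and \<phi>: "\<And>k w. \<phi> k w \<in> carrier_vec Z"
    and \<psi>: "\<And>d w. \<psi> d w \<in> carrier_vec S"
    and decodable: "\<And>k d W W'. \<lbrakk>k \<in> {1..K}; d \<in> {1..K} \<rightarrow>\<^sub>E {1..N};
        W \<in> {1..N} \<rightarrow> carrier_vec F; W' \<in> {1..N} \<rightarrow> carrier_vec F;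
        \<phi> k (concat_files N F W) = \<phi> k (concat_files N F W');
        \<psi> d (concat_files N F W) = \<psi> d (concat_files N F W')\<rbrakk> \<Longrightarrow> W (d k) = W' (d k)"
  shows "admits_caching_scheme TYPE('f) K M N F R"
proof -
  define cand where "cand = (\<lambda>k d ct W. W \<in> {1..N} \<rightarrow> carrier_vec F \<and>
    ct = (\<phi> k (concat_files N F W), \<psi> d (concat_files N F W)))"
  \<comment> \<open>A decoder must return a vector of length \<open>F\<close> even on pairs that
    arise from no files; the zero vector serves there.\<close>
  define \<mu> where "\<mu> = (\<lambda>k d ct. if \<exists>W. cand k d ct W then (SOME W. cand k d ct W) (d k) else 0\<^sub>v F)"
  have \<mu>_carrier: "\<mu> k d ct \<in> carrier_vec F"
    if "k \<in> {1..K}" "d \<in> {1..K} \<rightarrow>\<^sub>E {1..N}" for k d ct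
  proof (cases "\<exists>W. cand k d ct W")
    case True
    then have "cand k d ct (SOME W. cand k d ct W)" by (rule someI_ex)
    moreover have "d k \<in> {1..N}" using that by blast
    ultimately show ?thesis using True unfolding \<mu>_def cand_def by auto
  next
    case False
    then show ?thesis unfolding \<mu>_def by (simp only: if_False zero_carrier_vec)
  qed
  have \<mu>_decodes: "W (d k) = \<mu> k d (\<phi> k (concat_files N F W), \<psi> d (concat_files N F W))"
    if kd: "k \<in> {1..K}" "d \<in> {1..K} \<rightarrow>\<^sub>E {1..N}" and W: "W \<in> {1..N} \<rightarrow> carrier_vec F" for k d W
  proof -
    define ct where "ct = (\<phi> k (concat_files N F W), \<psi> d (concat_files N F W))"
    have ex: "\<exists>W. cand k d ct W" using W by (auto simp: cand_def ct_def)
    then have "cand k d ct (SOME W. cand k d ct W)" by (rule someI_ex)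
    \<comment> \<open>The chosen files may differ from \<open>W\<close> elsewhere, but they yield
      the same pair \<open>ct\<close>, so \<open>decodable\<close> forces agreement at the demanded
      index.\<close>
    then have "W (d k) = (SOME W. cand k d ct W) (d k)"
      by (intro decodable[OF kd W]) (auto simp: cand_def ct_def)
    then show ?thesis using ex by (simp add: \<mu>_def ct_def)
  qed
  have "caching_scheme K M N F R \<phi> \<psi> \<mu>"
    unfolding caching_scheme_def MF RF
    using \<open>0 < F\<close> \<phi> \<psi> \<mu>_carrier \<mu>_decodes by auto
  then show ?thesis unfolding admits_caching_scheme_def by blast
qed

section \<open>Coded delivery from an array\<close>

text \<open>The triples \<open>(u, p, t)\<close> encode a placement delivery array: they are the non-star
  entries \<open>t\<close> in row \<open>p\<close> and column \<open>u\<close>.\<close>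

lemma admits_caching_scheme_if_delivery_array:
  fixes U :: "'u set" and P :: "'q set" and T :: "'s set" and C :: "('u \<times> 'q \<times> 's) set"
  assumes fin: "finite U" "finite P" "finite T"
    and cards: "card U = K" "card P = F" "card T = S" and "0 < F"
    and C: "C \<subseteq> U \<times> P \<times> T"
    and missing: "\<And>u. u \<in> U \<Longrightarrow> card {p. \<exists>t. (u, p, t) \<in> C} = m"
    and array: "\<And>u p u' p' t t'. \<lbrakk>(u, p, t) \<in> C; (u', p', t) \<in> C; (u, p', t') \<in> C\<rbrakk>
      \<Longrightarrow> u' = u \<and> p' = p"
    and sys: "caching_system K M N" and MN: "M / real N = 1 - real m / real F"
    and RF: "R * real F = real S"
  shows "admits_caching_scheme TYPE('f :: {field, finite}) K M N F R"
proof -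
  obtain eu where eu: "bij_betw eu {1..K} U"
    using finite_same_card_bij[of "{1..K}" U] fin cards by auto
  obtain ep where ep: "bij_betw ep P {0..<F}"
    using ex_bij_betw_finite_nat fin cards by blast
  define iu where "iu = inv_into {1..K} eu"
  have iu: "eu (iu u) = u" "iu u \<in> {1..K}" if "u \<in> U" for u
    using that eu by (auto simp: iu_def bij_betw_def f_inv_into_f inv_into_into)
  have iu_eu: "iu (eu i) = i" if "i \<in> {1..K}" for i
    using that eu unfolding iu_def bij_betw_def by (metis inv_into_f_f)
  have "0 < K" and "0 < N" using sys by (auto simp: caching_system_def)
  define miss where "miss = (\<lambda>u. {p. \<exists>t. (u, p, t) \<in> C})"
  have miss_sub: "miss u \<subseteq> P" for u using C by (auto simp: miss_def)
  have card_miss: "card (miss u) = m" if "u \<in> U" for u using missing that by (simp add: miss_def)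
  \<comment> \<open>This makes the truncated subtraction in \<open>Z\<close> agree with real
    subtraction.\<close>
  have "m \<le> F"
  proof -
    have "eu 1 \<in> U" using eu \<open>0 < K\<close> by (auto simp: bij_betw_def)
    then have "m = card (miss (eu 1))" using card_miss by simp
    also have "\<dots> \<le> F" using card_mono[OF fin(2) miss_sub] cards by simp
    finally show ?thesis .
  qed
  define Z where "Z = N * (F - m)"
  have MF: "M * real F = real Z"
    using MN \<open>m \<le> F\<close> \<open>0 < N\<close> \<open>0 < F\<close> by (simp add: Z_def of_nat_diff field_simps)
  \<comment> \<open>A packet is a single field element. Files are numbered from 1 but coordinates
    from 0, hence \<open>n - 1\<close>.\<close>
  define pkt :: "'f vec \<Rightarrow> nat \<times> 'q \<Rightarrow> 'f" where
    "pkt = (\<lambda>w (n, p). w $ ((n - 1) * F + ep p))"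
  have ep_less: "ep p < F" if "p \<in> P" for p using ep that by (auto simp: bij_betw_def)
  have pkt_concat: "pkt (concat_files N F W) (n, p) = W n $ ep p"
    if "n \<in> {1..N}" "p \<in> P" for W n p
    using concat_files_index[OF that(1) ep_less[OF that(2)]] by (simp add: pkt_def)
  \<comment> \<open>Placement precedes the demands, so the same packet positions are stored for all
    \<open>N\<close> files.\<close>
  define stored where "stored = (\<lambda>i. {1..N} \<times> (P - miss (eu i)))"
  \<comment> \<open>The bound on lengths is required for every index \<open>i\<close>, the
    injectivity only for actual users; other indices get a zero vector.\<close>
  have "\<exists>enc :: (nat \<times> 'q \<Rightarrow> 'f) \<Rightarrow> 'f vec. (\<forall>x. enc x \<in> carrier_vec Z) \<and>
      (i \<in> {1..K} \<longrightarrow> (\<forall>x y. enc x = enc y \<longrightarrow> (\<forall>c\<in>stored i. x c = y c)))" for i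
  proof (cases "i \<in> {1..K}")
    case True
    then have "eu i \<in> U" using eu by (auto simp: bij_betw_def)
    then have "card (stored i) = Z"
      using card_miss miss_sub fin cards
      by (simp add: stored_def Z_def card_Diff_subset finite_subset[OF miss_sub] card_cartesian_product)
    moreover have "finite (stored i)" using fin by (simp add: stored_def)
    ultimately show ?thesis using ex_vec_encoding[of "stored i"] by metis
  next
    case False
    then show ?thesis by (intro exI[of _ "\<lambda>x. 0\<^sub>v Z"]) auto
  qed
  then obtain enc :: "nat \<Rightarrow> (nat \<times> 'q \<Rightarrow> 'f) \<Rightarrow> 'f vec" where
    enc_carrier: "\<And>i x. enc i x \<in> carrier_vec Z" and
    enc_inj: "\<And>i x y c. i \<in> {1..K} \<Longrightarrow> enc i x = enc i y \<Longrightarrow> c \<in> stored i \<Longrightarrow> x c = y c"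
    by metis
  obtain sig :: "('s \<Rightarrow> 'f) \<Rightarrow> 'f vec" where
    sig_carrier: "\<And>x. sig x \<in> carrier_vec S" and
    sig_inj: "\<And>x y t. sig x = sig y \<Longrightarrow> t \<in> T \<Longrightarrow> x t = y t"
    using ex_vec_encoding[of T] fin cards by metis
  define summands where "summands = (\<lambda>t. {(u, p). (u, p, t) \<in> C})"
  have fin_summands: "finite (summands t)" for t
    by (rule finite_subset[of _ "U \<times> P"]) (use C fin in \<open>auto simp: summands_def\<close>)
  define sent where "sent = (\<lambda>d w t. \<Sum>(u, p)\<in>summands t. pkt w (d (iu u), p))"
  show ?thesis
  proof (rule admits_caching_schemeI[where \<phi> = "\<lambda>i w. enc i (pkt w)" and \<psi> = "\<lambda>d w. sig (sent d w)",
        OF \<open>0 < F\<close> MF RF enc_carrier sig_carrier])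
    fix i d W W'
    assume i: "i \<in> {1..K}" and d: "d \<in> {1..K} \<rightarrow>\<^sub>E {1..N}"
      and W: "W \<in> {1..N} \<rightarrow> carrier_vec F" and W': "W' \<in> {1..N} \<rightarrow> carrier_vec F"
      and same_cache: "enc i (pkt (concat_files N F W)) = enc i (pkt (concat_files N F W'))"
      and same_sig: "sig (sent d (concat_files N F W)) = sig (sent d (concat_files N F W'))"
    define w where "w = concat_files N F W"
    define w' where "w' = concat_files N F W'"
    have di: "d i \<in> {1..N}" using d i by blast
    have cached: "pkt w (n, p) = pkt w' (n, p)" if "n \<in> {1..N}" "p \<in> P - miss (eu i)" for n p
      using enc_inj[OF i same_cache] that by (simp add: stored_def w_def w'_def)
    have "pkt w (d i, p) = pkt w' (d i, p)" if p: "p \<in> P" for p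
    proof (cases "p \<in> miss (eu i)")
      case False
      then show ?thesis using cached di p by simp
    next
      case True
      then obtain t where t: "(eu i, p, t) \<in> C" by (auto simp: miss_def)
      have "pkt w (d (iu u), q) = pkt w' (d (iu u), q)"
        if "(u, q) \<in> summands t - {(eu i, p)}" for u q
      proof -
        have uq: "(u, q, t) \<in> C" and ne: "(u, q) \<noteq> (eu i, p)"
          using that by (auto simp: summands_def)
        \<comment> \<open>If this user also missed \<open>q\<close>, then \<open>array\<close> would
          identify \<open>(u, q)\<close> with the user's own summand.\<close>
        have "q \<notin> miss (eu i)" using array[OF t uq] ne by (auto simp: miss_def)
        moreover have "q \<in> P" "d (iu u) \<in> {1..N}" using uq C d iu by (blast+)
        ultimately show ?thesis using cached by simp
      qed
      \<comment> \<open>All interfering summands agree, and so do the full sums; cancelling leaves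
        equality of the wanted packet.\<close>
      then have "(\<Sum>(u, q)\<in>summands t - {(eu i, p)}. pkt w (d (iu u), q)) =
          (\<Sum>(u, q)\<in>summands t - {(eu i, p)}. pkt w' (d (iu u), q))"
        by (intro sum.cong) auto
      moreover have "sent d w t = sent d w' t"
        using sig_inj[OF same_sig] t C by (auto simp: w_def w'_def)
      moreover have "(eu i, p) \<in> summands t" using t by (simp add: summands_def)
      ultimately show ?thesis
        using iu_eu[OF i] by (simp add: sent_def sum.remove[OF fin_summands])
    qed
    then have "W (d i) $ ep p = W' (d i) $ ep p" if "p \<in> P" for p
      using pkt_concat di that by (simp add: w_def w'_def)
    moreover have "\<exists>p\<in>P. ep p = j" if "j < F" for j
      using ep that unfolding bij_betw_def by (metis atLeastLessThan_iff imageE zero_le)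
    moreover have "W (d i) \<in> carrier_vec F" "W' (d i) \<in> carrier_vec F"
      using W W' di by auto
    ultimately show "W (d i) = W' (d i)"
      by (intro eq_vecI) (metis carrier_vecD)+
  qed
qed

section \<open>Permutations of the blocks\<close>

text \<open>The cyclic shift \<open>s\<close> of \<open>{0..<n}\<close> is transported to
  \<open>X\<close> along an enumeration. It fixes a point only when \<open>n = 1\<close>.\<close>

lemma ex_fixpoint_free_permutation:
  assumes "finite X"
  shows "\<exists>g. bij_betw g X X \<and> (card X \<noteq> 1 \<longrightarrow> (\<forall>x\<in>X. g x \<noteq> x))"
proof -
  define n where "n = card X"
  obtain h where h: "bij_betw h X {0..<n}"
    using ex_bij_betw_finite_nat[OF assms] n_def by blast
  define s where "s = (\<lambda>i. if Suc i = n then 0 else Suc i)"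
  have "inj_on s {0..<n}" by (auto simp: inj_on_def s_def split: if_splits)
  moreover have "s ` {0..<n} \<subseteq> {0..<n}" by (auto simp: s_def)
  ultimately have s: "bij_betw s {0..<n} {0..<n}"
    by (simp add: bij_betw_def endo_inj_surj)
  define g where "g = inv_into X h \<circ> (s \<circ> h)"
  have g: "bij_betw g X X"
    unfolding g_def using bij_betw_trans[OF h s] bij_betw_inv_into[OF h] by (rule bij_betw_trans)
  have "g x \<noteq> x" if "n \<noteq> 1" "x \<in> X" for x
  proof
    assume "g x = x"
    have "h x < n" using h that by (auto simp: bij_betw_def)
    then have "s (h x) \<in> h ` X" using h s by (auto simp: bij_betw_def)
    then have "h (g x) = s (h x)" by (simp add: g_def f_inv_into_f)
    then show False using \<open>g x = x\<close> \<open>n \<noteq> 1\<close> by (auto simp: s_def split: if_splits)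
  qed
  then show ?thesis using g n_def by blast
qed

lemma configuration_blocks_eqI:
  assumes conf: "configuration V \<B> v r b k"
    and "X \<in> \<B>" "Y \<in> \<B>" "x \<in> X \<inter> Y" "y \<in> X \<inter> Y" "x \<noteq> y"
  shows "X = Y"
proof -
  have "finite \<B>" using conf finite_subset[of \<B> "Pow V"] by (auto simp: configuration_def)
  then have "finite {Z \<in> \<B>. {x, y} \<subseteq> Z}" by simp
  moreover have "{x, y} \<subseteq> V \<and> card {x, y} = 2" using conf assms by (auto simp: configuration_def)
  then have "card {Z \<in> \<B>. {x, y} \<subseteq> Z} \<le> Suc 0"
    using conf unfolding configuration_def One_nat_def by blast
  ultimately have "\<forall>X\<in>{Z \<in> \<B>. {x, y} \<subseteq> Z}. \<forall>Y\<in>{Z \<in> \<B>. {x, y} \<subseteq> Z}. X = Y"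
    by (simp only: card_le_Suc0_iff_eq)
  then show ?thesis using assms by blast
qed

text \<open>For \<open>k \<noteq> 1\<close>, the points \<open>y\<close> and \<open>g X y\<close>
  are distinct and common to both blocks, so the blocks coincide. For \<open>k = 1\<close> the
  permutations have fixed points, but singleton blocks sharing \<open>y\<close> are equal
  anyway.\<close>

lemma configuration_block_permutations:
  assumes conf: "configuration V \<B> v r b k"
  obtains g where "\<And>X. X \<in> \<B> \<Longrightarrow> bij_betw (g X) X X"
    and "\<And>X Y y. \<lbrakk>X \<in> \<B>; Y \<in> \<B>; y \<in> X; y \<in> Y; g X y \<in> Y\<rbrakk> \<Longrightarrow> X = Y"
proof -
  have "finite X" if "X \<in> \<B>" for X
    using that conf finite_subset[of X V] by (auto simp: configuration_def)
  then have "\<forall>X\<in>\<B>. \<exists>g. bij_betw g X X \<and> (card X \<noteq> 1 \<longrightarrow> (\<forall>x\<in>X. g x \<noteq> x))"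
    using ex_fixpoint_free_permutation by blast
  then obtain g where g: "\<And>X. X \<in> \<B> \<Longrightarrow> bij_betw (g X) X X"
    and free: "\<And>X x. X \<in> \<B> \<Longrightarrow> card X \<noteq> 1 \<Longrightarrow> x \<in> X \<Longrightarrow> g X x \<noteq> x"
    by metis
  have "X = Y" if "X \<in> \<B>" "Y \<in> \<B>" "y \<in> X" "y \<in> Y" "g X y \<in> Y" for X Y y
  proof (cases "k = 1")
    case True
    then have "card X = 1" "card Y = 1" using that conf by (auto simp: configuration_def)
    then show ?thesis using that by (metis card_1_singletonE singletonD)
  next
    case False
    then have "g X y \<noteq> y" using that conf free by (auto simp: configuration_def)
    moreover have "g X y \<in> X" using g that by (auto simp: bij_betw_def)
    ultimately show ?thesis using configuration_blocks_eqI[OF conf] that by blast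
  qed
  then show thesis using that g by blast
qed

section \<open>The three schemes of a configuration\<close>

theorem theorem4:
  fixes v r b k :: nat
  assumes "0 < v" and "0 < r" and "0 < b" and "0 < k"
    and "\<exists>(V :: 'p set) \<B>. configuration V \<B> v r b k"
  shows
    "(\<forall>M N. caching_system v M N \<and> M / real N = 1 - real r / real v \<longrightarrow>
        admits_caching_scheme TYPE('f :: {field, finite}) v M N v (real r / real k)) \<and>
     (\<forall>M N. caching_system v M N \<and> M / real N = 1 - real k / real v \<longrightarrow>
        admits_caching_scheme TYPE('f) v M N (v * r div k) (real k / real r)) \<and>
     (\<forall>M N. caching_system (v * r div k) M N \<and> M / real N = 1 - real k / real v \<longrightarrow>
        admits_caching_scheme TYPE('f) (v * r div k) M N v 1)"
proof -
  obtain V :: "'p set" and \<B> where conf: "configuration V \<B> v r b k" using assms(5) by blast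
  note div_b = configuration_div_exact(1)[OF conf \<open>0 < k\<close>]
  have "real b * real k = real v * real r"
    using configuration_double_count[OF conf] by (metis of_nat_mult)
  \<comment> \<open>The identity \<open>ratio\<close> is for the second scheme, where a user misses
    \<open>r\<close> of \<open>b\<close> packets.\<close>
  then have rate1: "real r / real k * real v = real b"
    and rate2: "real k / real r * real b = real v"
    and ratio: "real k / real v = real r / real b"
    using assms(1-4) by (simp_all add: field_simps)
  have fin: "finite V" "finite \<B>" and cards: "card V = v" "card \<B> = b"
    and block: "\<And>X. X \<in> \<B> \<Longrightarrow> X \<subseteq> V \<and> card X = k"
    and point: "\<And>x. x \<in> V \<Longrightarrow> card {X \<in> \<B>. x \<in> X} = r"
    using conf finite_subset[of \<B> "Pow V"] by (auto simp: configuration_def)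
  obtain g where g: "\<And>X. X \<in> \<B> \<Longrightarrow> bij_betw (g X) X X"
    and g_eq: "\<And>X Y y. \<lbrakk>X \<in> \<B>; Y \<in> \<B>; y \<in> X; y \<in> Y; g X y \<in> Y\<rbrakk> \<Longrightarrow> X = Y"
    using configuration_block_permutations[OF conf] by blast
  have g_in: "g X y \<in> X" if "X \<in> \<B>" "y \<in> X" for X y using g that by (auto simp: bij_betw_def)
  have g_inj: "y = z" if "X \<in> \<B>" "y \<in> X" "z \<in> X" "g X y = g X z" for X y z
    using g that by (metis bij_betw_def inj_onD)
  have g_surj: "\<exists>y\<in>X. g X y = x" if "X \<in> \<B>" "x \<in> X" for X x
    using g that by (metis bij_betw_def imageE)
  \<comment> \<open>Users and packets are points, signals are blocks: a user \<open>y\<close> misses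
    the successor of \<open>y\<close> in each block through \<open>y\<close>.\<close>
  have "admits_caching_scheme TYPE('f) v M N v (real r / real k)"
    if "caching_system v M N" "M / real N = 1 - real r / real v" for M N
  proof (rule admits_caching_scheme_if_delivery_array[where m = r and
        C = "{(y, g X y, X) | X y. X \<in> \<B> \<and> y \<in> X}",
        OF fin(1,1,2) cards(1,1,2) \<open>0 < v\<close> _ _ _ that rate1])
    show "{(y, g X y, X) | X y. X \<in> \<B> \<and> y \<in> X} \<subseteq> V \<times> V \<times> \<B>" using block g_in by blast
  next
    fix x assume "x \<in> V"
    have "{p. \<exists>X. (x, p, X) \<in> {(y, g X y, X) | X y. X \<in> \<B> \<and> y \<in> X}} =
        (\<lambda>X. g X x) ` {X \<in> \<B>. x \<in> X}" by auto
    \<comment> \<open>If \<open>g X x = g Y x\<close>, this point lies in \<open>Y\<close> together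
      with \<open>x\<close>, so \<open>g_eq\<close> gives \<open>X = Y\<close>. Hence the
      \<open>r\<close> blocks yield \<open>r\<close> different missing packets.\<close>
    moreover have "inj_on (\<lambda>X. g X x) {X \<in> \<B>. x \<in> X}"
      by (rule inj_onI) (use g_eq g_in in \<open>metis (lifting) mem_Collect_eq\<close>)
    ultimately show "card {p. \<exists>X. (x, p, X) \<in> {(y, g X y, X) | X y. X \<in> \<B> \<and> y \<in> X}} = r"
      using point[OF \<open>x \<in> V\<close>] by (simp add: card_image)
  next
    fix x p x' p' X Y
    assume "(x, p, X) \<in> {(y, g X y, X) | X y. X \<in> \<B> \<and> y \<in> X}"
      and "(x', p', X) \<in> {(y, g X y, X) | X y. X \<in> \<B> \<and> y \<in> X}"
      and "(x, p', Y) \<in> {(y, g X y, X) | X y. X \<in> \<B> \<and> y \<in> X}"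
    then have *: "X \<in> \<B>" "x \<in> X" "p = g X x" "x' \<in> X" "p' = g X x'" "Y \<in> \<B>" "x \<in> Y" "p' = g Y x"
      by auto
    \<comment> \<open>The point \<open>g Y x = g X x'\<close> lies in \<open>X\<close>, as does
      \<open>x\<close>.\<close>
    then have "Y = X" using g_eq[of Y X x] g_in[of X x'] by simp
    then show "x' = x \<and> p' = p" using * g_inj[of X x' x] by metis
  qed
  \<comment> \<open>Users and signals are points, packets are blocks. As each \<open>g X\<close> is
    onto \<open>X\<close>, a user misses exactly the blocks through it.\<close>
  moreover have "admits_caching_scheme TYPE('f) v M N b (real k / real r)"
    if "caching_system v M N" "M / real N = 1 - real k / real v" for M N
  proof (rule admits_caching_scheme_if_delivery_array[where m = r and
        C = "{(g X y, X, y) | X y. X \<in> \<B> \<and> y \<in> X}",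
        OF fin(1,2,1) cards(1,2,1) \<open>0 < b\<close> _ _ _ that[unfolded ratio] rate2])
    show "{(g X y, X, y) | X y. X \<in> \<B> \<and> y \<in> X} \<subseteq> V \<times> \<B> \<times> V" using block g_in by blast
  next
    fix x assume "x \<in> V"
    have "{X. \<exists>y. (x, X, y) \<in> {(g X y, X, y) | X y. X \<in> \<B> \<and> y \<in> X}} = {X \<in> \<B>. x \<in> X}"
      using g_in g_surj by fastforce
    then show "card {X. \<exists>y. (x, X, y) \<in> {(g X y, X, y) | X y. X \<in> \<B> \<and> y \<in> X}} = r"
      using point[OF \<open>x \<in> V\<close>] by simp
  next
    fix x X x' X' y y'
    assume "(x, X, y) \<in> {(g X y, X, y) | X y. X \<in> \<B> \<and> y \<in> X}"
      and "(x', X', y) \<in> {(g X y, X, y) | X y. X \<in> \<B> \<and> y \<in> X}"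
      and "(x, X', y') \<in> {(g X y, X, y) | X y. X \<in> \<B> \<and> y \<in> X}"
    then have *: "X \<in> \<B>" "y \<in> X" "x = g X y" "X' \<in> \<B>" "y \<in> X'" "x' = g X' y" "x \<in> X'"
      using g_in by auto
    then have "X = X'" using g_eq by blast
    then show "x' = x \<and> X' = X" using * by metis
  qed
  \<comment> \<open>Users are blocks, packets and signals are points. As \<open>g X\<close> is onto
    \<open>X\<close>, the user \<open>X\<close> misses exactly its own points.\<close>
  moreover have "admits_caching_scheme TYPE('f) b M N v 1"
    if "caching_system b M N" "M / real N = 1 - real k / real v" for M N
  proof (rule admits_caching_scheme_if_delivery_array[where m = k and
        C = "{(X, g X y, y) | X y. X \<in> \<B> \<and> y \<in> X}",
        OF fin(2,1,1) cards(2,1,1) \<open>0 < v\<close> _ _ _ that])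
    show "{(X, g X y, y) | X y. X \<in> \<B> \<and> y \<in> X} \<subseteq> \<B> \<times> V \<times> V" using block g_in by blast
  next
    fix X assume "X \<in> \<B>"
    then have "{p. \<exists>y. (X, p, y) \<in> {(X, g X y, y) | X y. X \<in> \<B> \<and> y \<in> X}} = X"
      using g_in g_surj by fastforce
    then show "card {p. \<exists>y. (X, p, y) \<in> {(X, g X y, y) | X y. X \<in> \<B> \<and> y \<in> X}} = k"
      using block[OF \<open>X \<in> \<B>\<close>] by simp
  next
    fix X p X' p' y y'
    assume "(X, p, y) \<in> {(X, g X y, y) | X y. X \<in> \<B> \<and> y \<in> X}"
      and "(X', p', y) \<in> {(X, g X y, y) | X y. X \<in> \<B> \<and> y \<in> X}"
      and "(X, p', y') \<in> {(X, g X y, y) | X y. X \<in> \<B> \<and> y \<in> X}"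
    then have *: "X \<in> \<B>" "y \<in> X" "p = g X y" "X' \<in> \<B>" "y \<in> X'" "p' = g X' y" "p' \<in> X"
      using g_in by auto
    \<comment> \<open>Both \<open>y\<close> and \<open>g X' y\<close> lie in
      \<open>X\<close>.\<close>
    then have "X' = X" using g_eq by blast
    then show "X' = X \<and> p' = p" using * by metis
  qed simp
  ultimately show ?thesis unfolding div_b by blast
qed

end
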